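(* Let $G$ be a connected graph of order $n \ge 3$ with minimum degree $\delta \ge 2$ and maximum degree $\Delta$. Then \[ \gamma_{\rm it}^{\rm g}(G) \le \left( \frac{2\delta-1}{3\delta-2} \right) n - \frac{\Delta - 2}{3\delta-2}, \] where $\gamma_{\rm it}^{\rm g}(G)$ denotes the game total isolation number of $G$ (Dominator-start).
   Context: All graphs are finite and simple. For a vertex set $S$, $N_G(S)$ denotes the set of vertices adjacent to at least one vertex of $S$ (open neighborhood), and $G - X$ is the graph obtained by deleting the vertices of $X$. The total isolation game on a graph $G$ is played by two players, Dominator and Staller, who alternately select vertices of $G$. If $S$ is the set of vertices selected so far, a vertex $v$ may be selected (is playable) only if $v$ is adjacent to some vertex $u$ such that either $u$ belongs to a component of $G - N_G(S)$ of order at least $2$, or $u \in S$ and $u$ is an isolated vertex of $G - N_G(S)$. The game ends when no playable vertex exists. Dominator aims to minimize the total number of selected vertices, Staller aims to maximize it. The game total isolation number $\gamma_{\rm it}^{\rm g}(G)$ is the number of moves in the game in which Dominator makes the first move and both players play optimally. *)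

theory Defs
  imports Complex_Main "Graph_Theory.Graph_Theory"
begin

text \<open>
  Finite simple graphs are instances of the locale \<^locale>\<open>graph\<close>: symmetric digraphs without loops
  and parallel arcs, each edge being a pair of opposite arcs.  Consequently the degree of a vertex
  is its out-degree, and the connected components are the strongly connected ones.
\<close>

context graph
begin

definition min_degree :: nat where
  "min_degree = Min (out_degree G ` verts G)"

definition max_degree :: nat where
  "max_degree = Max (out_degree G ` verts G)"

definition open_nbhd :: "'a set \<Rightarrow> 'a set" where
  "open_nbhd S = {v \<in> verts G. \<exists>u\<in>S. v \<rightarrow> u}"

definition residual :: "'a set \<Rightarrow> ('a, 'b) pre_digraph" where
  "residual S = G \<restriction> (verts G - open_nbhd S)"

definition playable :: "'a set \<Rightarrow> 'a set" where
  "playable S = {v \<in> verts G. \<exists>u \<in> verts (residual S). v \<rightarrow> u \<and>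
     ((\<exists>C \<in> pre_digraph.sccs_verts (residual S). u \<in> C \<and> card C \<ge> 2) \<or>
      (u \<in> S \<and> out_degree (residual S) u = 0))}"

lemma finite_playable: "finite (playable S)"
  by (simp add: playable_def)

text \<open>The rules never allow a vertex to be selected twice, so the game terminates.\<close>

lemma playable_fresh: "playable S \<subseteq> verts G - S"
proof
  fix v assume "v \<in> playable S"
  then obtain u where v: "v \<in> verts G" and u: "u \<in> verts G" "u \<notin> open_nbhd S" and "v \<rightarrow> u"
    by (auto simp: playable_def residual_def)
  then have "u \<rightarrow> v" by (blast intro: graph_symmetric)
  with u have "v \<notin> S" by (auto simp: open_nbhd_def)
  with v show "v \<in> verts G - S" by simp
qed

end

datatype player = Dominator | Staller

context graph
begin

text \<open>
  \<open>remaining_moves p S\<close> is the number of further moves under optimal play when the vertices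
  in \<open>S\<close> have been selected and it is the turn of \<open>p\<close>.
\<close>

function remaining_moves :: "player \<Rightarrow> 'a set \<Rightarrow> nat" where
  "remaining_moves Dominator S =
    (if playable S = {} then 0
     else Suc (Min ((\<lambda>v. remaining_moves Staller (insert v S)) ` playable S)))"
| "remaining_moves Staller S =
    (if playable S = {} then 0
     else Suc (Max ((\<lambda>v. remaining_moves Dominator (insert v S)) ` playable S)))"
  by pat_completeness auto
termination
proof (relation "measure (\<lambda>(p, S). card (verts G - S))")
  have *: "card (verts G - insert v S) < card (verts G - S)" if "v \<in> playable S" for v S
    using that playable_fresh[of S] by (intro psubset_card_mono) auto
  show "((Staller, insert v S), (Dominator, S)) \<in> measure (\<lambda>(p, S). card (verts G - S))"
    if "v \<in> playable S" for S v
    using *[OF that] by simp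
  show "((Dominator, insert v S), (Staller, S)) \<in> measure (\<lambda>(p, S). card (verts G - S))"
    if "v \<in> playable S" for S v
    using *[OF that] by simp
qed simp

definition game_total_isolation_number :: nat where
  "game_total_isolation_number = remaining_moves Dominator {}"

end

end

theory Submission
  imports Defs
begin

text \<open>
  Call a vertex dominated if it lies in \<open>N(S)\<close>.  Dominator opens with a vertex of maximum degree and
  afterwards, as long as he can, plays a vertex that dominates at least two new vertices; since
  every move dominates at least one new vertex, the number of dominated vertices stays about
  \<open>3/2\<close> times the number of moves, with a surplus of \<open>\<Delta> - 2\<close>.  Once he cannot, every playable vertex
  has exactly one undominated neighbour.  Each of the remaining \<open>T\<close> moves then uses up one of the
  useful vertices, which are the vertices whose neighbours are playable.  Their neighbourhoods are
  now pairwise disjoint, contain at least \<open>\<delta>\<close> vertices each, and avoid the vertices selected so far,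
  so that \<open>card S + \<delta> T \<le> n\<close>.  Combined with \<open>card (N(S)) + T \<le> n\<close>, this gives the bound.
\<close>

context graph
begin

section \<open>Neighbourhoods and degrees\<close>

lemma dominates_sym: "u \<rightarrow> v \<longleftrightarrow> v \<rightarrow> u"
  using graph_symmetric by blast

lemma finite_open_nbhd [simp]: "finite (open_nbhd S)"
  by (simp add: open_nbhd_def)

lemma open_nbhd_subset: "open_nbhd S \<subseteq> verts G"
  by (auto simp: open_nbhd_def)

lemma in_open_nbhd_singleton: "u \<in> open_nbhd {v} \<longleftrightarrow> v \<rightarrow> u"
  using dominates_sym by (auto simp: open_nbhd_def)

lemma open_nbhd_insert: "open_nbhd (insert v S) = open_nbhd {v} \<union> open_nbhd S"
  by (auto simp: open_nbhd_def)

text \<open>Without parallel arcs, \<open>head G\<close> is a bijection from the arcs leaving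
  \<open>v\<close> to its neighbours.\<close>

lemma card_open_nbhd_singleton: "card (open_nbhd {v}) = out_degree G v"
proof -
  have "inj_on (head G) (out_arcs G v)"
    using no_multi_arcs by (auto simp: inj_on_def arc_to_ends_def)
  moreover have "head G ` out_arcs G v = open_nbhd {v}"
    unfolding set_eq_iff in_open_nbhd_singleton by (auto simp: arcs_ends_def arc_to_ends_def)
  ultimately show ?thesis
    unfolding out_degree_def by (metis card_image)
qed

lemma min_degree_le:
  assumes "v \<in> verts G"
  shows "min_degree \<le> card (open_nbhd {v})"
  using assms by (simp add: min_degree_def card_open_nbhd_singleton)

section \<open>Useful vertices and playability\<close>

text \<open>A local form of the rules: lying in a component of order at least 2 of
  \<open>residual S\<close> amounts to having a neighbour there, and an undominated vertex of
  \<open>S\<close> is isolated there, since its neighbours are all dominated.\<close>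

definition useful :: "'a set \<Rightarrow> 'a set" where
  "useful S = {u \<in> verts G - open_nbhd S. u \<in> S \<or> (\<exists>w \<in> verts G - open_nbhd S. u \<rightarrow> w)}"

lemma finite_useful [simp]: "finite (useful S)"
  by (simp add: useful_def)

lemma dominates_residual_iff:
  "u \<rightarrow>\<^bsub>residual S\<^esub> w \<longleftrightarrow> u \<rightarrow> w \<and> u \<in> verts G - open_nbhd S \<and> w \<in> verts G - open_nbhd S"
  by (auto simp: residual_def arcs_ends_def arc_to_ends_def)

lemma playable_eq: "playable S = {v. \<exists>u \<in> useful S. v \<rightarrow> u}"
proof (intro set_eqI iffI)
  fix v assume "v \<in> playable S"
  then obtain u where u: "u \<in> verts (residual S)" "v \<rightarrow> u"
    and *: "(\<exists>C \<in> pre_digraph.sccs_verts (residual S). u \<in> C \<and> card C \<ge> 2) \<or> u \<in> S"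
    by (auto simp: playable_def)
  have "u \<in> S \<or> (\<exists>w \<in> verts G - open_nbhd S. u \<rightarrow> w)"
    using *
  proof (elim disjE bexE conjE)
    fix C assume C: "C \<in> pre_digraph.sccs_verts (residual S)" "u \<in> C" "card C \<ge> 2"
    then obtain w where w: "w \<in> C" "w \<noteq> u"
      by (metis One_nat_def card_le_Suc0_iff_eq card.infinite le_numeral_extra(2)
          not_less_eq_eq numeral_2_eq_2 zero_le)
    with C have "u \<rightarrow>\<^sup>*\<^bsub>residual S\<^esub> w"
      by (auto simp: pre_digraph.sccs_verts_def)
    \<comment> \<open>As \<open>w\<close> differs from \<open>u\<close>, the walk has a first arc;
      its head \<open>x\<close> is an undominated neighbour of \<open>u\<close>.\<close>
    with w obtain x where "u \<rightarrow>\<^bsub>residual S\<^esub> x"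
      by (metis pre_digraph.converse_reachable_cases)
    then show ?thesis
      by (auto simp: dominates_residual_iff)
  qed simp
  with u show "v \<in> {v. \<exists>u \<in> useful S. v \<rightarrow> u}"
    by (auto simp: useful_def residual_def)
next
  fix v assume "v \<in> {v. \<exists>u \<in> useful S. v \<rightarrow> u}"
  then obtain u where vu: "v \<rightarrow> u" and u: "u \<in> verts G" "u \<notin> open_nbhd S"
    and *: "u \<in> S \<or> (\<exists>w \<in> verts G - open_nbhd S. u \<rightarrow> w)"
    by (auto simp: useful_def)
  interpret R: wf_digraph "residual S"
    unfolding residual_def by (rule wellformed_induce_subgraph)
  have "(\<exists>C \<in> pre_digraph.sccs_verts (residual S). u \<in> C \<and> card C \<ge> 2) \<or>
      (u \<in> S \<and> out_degree (residual S) u = 0)"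
  proof (cases "u \<in> S")
    case True
    \<comment> \<open>Selecting \<open>u\<close> dominated all its neighbours, so no arc leaving
      \<open>u\<close> survives in the residual graph.\<close>
    then have "w \<in> open_nbhd S" if "u \<rightarrow> w" for w
      using that dominates_sym adj_in_verts by (auto simp: open_nbhd_def)
    then have "head G e \<in> open_nbhd S" if "e \<in> arcs G" "tail G e = u" for e
      using that in_arcs_imp_in_arcs_ends by blast
    then have "out_arcs (residual S) u = {}"
      by (auto simp: out_arcs_def residual_def)
    with True show ?thesis
      by (simp add: out_degree_def)
  next
    case False
    with * obtain w where w: "w \<in> verts G - open_nbhd S" "u \<rightarrow> w"
      by blast
    \<comment> \<open>Both directions of the edge survive, which puts \<open>u\<close> and
      \<open>w\<close> in the same strong component.\<close>
    with u have uw: "u \<rightarrow>\<^bsub>residual S\<^esub> w" "w \<rightarrow>\<^bsub>residual S\<^esub> u"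
      using dominates_sym by (auto simp: dominates_residual_iff)
    have uV: "u \<in> verts (residual S)"
      using u by (simp add: residual_def)
    let ?C = "R.scc_of u"
    have "{u, w} \<subseteq> ?C"
      using uw uV by (auto simp: R.scc_of_def)
    moreover have "u \<noteq> w"
      using w adj_not_same by blast
    moreover have "finite ?C"
    proof (rule finite_subset)
      show "?C \<subseteq> verts G"
        using R.sccs_verts_subsets[OF R.scc_of_in_sccs_verts[OF uV]]
        by (auto simp: residual_def)
    qed simp
    ultimately have "2 \<le> card ?C"
      by (metis card_2_iff card_mono)
    moreover have "u \<in> ?C"
      using \<open>{u, w} \<subseteq> ?C\<close> by simp
    ultimately show ?thesis
      using R.scc_of_in_sccs_verts[OF uV] by blast
  qed
  moreover have "v \<in> verts G"
    using vu by (rule adj_in_verts)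
  ultimately show "v \<in> playable S"
    using u vu unfolding playable_def by (auto simp: residual_def)
qed

text \<open>The move dominates a useful neighbour of \<open>v\<close>, which is then lost. No vertex
  becomes useful: only \<open>v\<close> enters \<open>S\<close>, and if undominated it was useful
  already, by its undominated neighbour.\<close>

lemma useful_insert_psubset:
  assumes v: "v \<in> playable S"
  shows "useful (insert v S) \<subset> useful S"
proof -
  have *: "v \<in> useful S" if "v \<notin> open_nbhd S"
    using that v adj_in_verts by (auto simp: playable_eq useful_def)
  have mono: "open_nbhd S \<subseteq> open_nbhd (insert v S)"
    by (subst open_nbhd_insert) auto
  have "useful (insert v S) \<subseteq> useful S"
  proof
    fix u assume u: "u \<in> useful (insert v S)"
    show "u \<in> useful S"
    proof (cases "u = v")
      case True
      with u mono * show ?thesis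
        by (auto simp: useful_def)
    next
      case False
      with u mono show ?thesis
        unfolding useful_def by blast
    qed
  qed
  moreover obtain u where u: "u \<in> useful S" "v \<rightarrow> u"
    using v by (auto simp: playable_eq)
  then have "u \<notin> useful (insert v S)"
    unfolding useful_def by (subst open_nbhd_insert) (auto simp: in_open_nbhd_singleton)
  ultimately show ?thesis
    using u by blast
qed

section \<open>Optimal play and the length of the game\<close>

declare remaining_moves.simps [simp del]

lemma remaining_moves_eq_0: "playable S = {} \<Longrightarrow> remaining_moves p S = 0"
  by (cases p) (simp_all add: remaining_moves.simps)

lemma remaining_moves_Dominator_le:
  assumes "v \<in> playable S"
  shows "remaining_moves Dominator S \<le> Suc (remaining_moves Staller (insert v S))"
proof -
  have "Min ((\<lambda>v. remaining_moves Staller (insert v S)) ` playable S)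
      \<le> remaining_moves Staller (insert v S)"
    using assms by (intro Min_le finite_imageI finite_playable imageI)
  moreover have "playable S \<noteq> {}"
    using assms by blast
  ultimately show ?thesis
    by (subst remaining_moves.simps) simp
qed

lemma remaining_moves_Staller_attained:
  assumes "playable S \<noteq> {}"
  obtains v where "v \<in> playable S"
    and "remaining_moves Staller S = Suc (remaining_moves Dominator (insert v S))"
proof -
  let ?M = "(\<lambda>v. remaining_moves Dominator (insert v S)) ` playable S"
  have "Max ?M \<in> ?M"
    using assms by (intro Max_in finite_imageI finite_playable) simp
  then obtain v where "v \<in> playable S" "Max ?M = remaining_moves Dominator (insert v S)"
    by blast
  then show thesis
    using assms that by (simp add: remaining_moves.simps(2)[of S])
qed

text \<open>Every move, whoever makes it, removes a useful vertex, so the bound holds however the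
  game is played.\<close>

lemma remaining_moves_le_card_useful: "remaining_moves p S \<le> card (useful S)"
proof (induction p S rule: remaining_moves.induct)
  case (1 S)
  show ?case
  proof (cases "playable S = {}")
    case False
    then obtain v where v: "v \<in> playable S"
      by blast
    have "remaining_moves Staller (insert v S) \<le> card (useful (insert v S))"
      using 1 v False by blast
    also have "\<dots> < card (useful S)"
      using useful_insert_psubset[OF v] by (simp add: psubset_card_mono)
    finally show ?thesis
      using remaining_moves_Dominator_le[OF v] by linarith
  qed (simp add: remaining_moves_eq_0)
next
  case (2 S)
  show ?case
  proof (cases "playable S = {}")
    case False
    then obtain v where v: "v \<in> playable S"
      and eq: "remaining_moves Staller S = Suc (remaining_moves Dominator (insert v S))"
      by (rule remaining_moves_Staller_attained)
    have "remaining_moves Dominator (insert v S) \<le> card (useful (insert v S))"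
      using 2 v False by blast
    also have "\<dots> < card (useful S)"
      using useful_insert_psubset[OF v] by (simp add: psubset_card_mono)
    finally show ?thesis
      using eq by linarith
  qed (simp add: remaining_moves_eq_0)
qed

section \<open>Counting useful and dominated vertices\<close>

lemma card_open_nbhd_add_useful: "card (open_nbhd S) + card (useful S) \<le> card (verts G)"
proof -
  have "card (open_nbhd S) + card (useful S) = card (open_nbhd S \<union> useful S)"
    by (rule card_Un_disjoint[symmetric]) (auto simp: useful_def)
  also have "\<dots> \<le> card (verts G)"
    using open_nbhd_subset by (intro card_mono) (auto simp: useful_def)
  finally show ?thesis .
qed

text \<open>The neighbours of an undominated vertex are unselected, whence the term \<open>card S\<close>.\<close>

lemma card_add_useful_le:
  assumes S: "S \<subseteq> verts G"
    and one: "\<And>v. v \<in> playable S \<Longrightarrow> card (open_nbhd {v} - open_nbhd S) \<le> 1"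
  shows "card S + min_degree * card (useful S) \<le> card (verts G)"
proof -
  \<comment> \<open>A common neighbour of two useful vertices would be playable and dominate both,
    against \<open>one\<close>.\<close>
  have disj: "open_nbhd {u} \<inter> open_nbhd {u'} = {}"
    if "u \<in> useful S" "u' \<in> useful S" "u \<noteq> u'" for u u'
  proof (rule ccontr)
    assume "open_nbhd {u} \<inter> open_nbhd {u'} \<noteq> {}"
    then obtain v where v: "v \<rightarrow> u" "v \<rightarrow> u'"
      using dominates_sym by (auto simp: in_open_nbhd_singleton)
    with that have "card (open_nbhd {v} - open_nbhd S) \<le> 1"
      by (intro one) (auto simp: playable_eq)
    moreover have "{u, u'} \<subseteq> open_nbhd {v} - open_nbhd S"
      using v that by (auto simp: in_open_nbhd_singleton useful_def)
    ultimately show False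
      using that(3) card_mono[of "open_nbhd {v} - open_nbhd S" "{u, u'}"] by simp
  qed
  let ?U = "\<Union>u\<in>useful S. open_nbhd {u}"
  have "min_degree * card (useful S) = (\<Sum>u\<in>useful S. min_degree)"
    by simp
  also have "\<dots> \<le> (\<Sum>u\<in>useful S. card (open_nbhd {u}))"
    by (intro sum_mono min_degree_le) (auto simp: useful_def)
  also have "\<dots> = card ?U"
    using disj by (intro card_UN_disjoint[symmetric]) auto
  finally have "card S + min_degree * card (useful S) \<le> card S + card ?U"
    by simp
  also have "\<dots> = card (S \<union> ?U)"
  proof (rule card_Un_disjoint[symmetric])
    have "u \<in> open_nbhd S" if "v \<in> S" "v \<in> open_nbhd {u}" "u \<in> verts G" for u v
      using that dominates_sym[of u v] by (auto simp: open_nbhd_def)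
    then show "S \<inter> ?U = {}"
      unfolding useful_def by blast
  qed (use S in \<open>auto intro: finite_subset\<close>)
  also have "\<dots> \<le> card (verts G)"
    using S open_nbhd_subset by (intro card_mono) auto
  finally show ?thesis .
qed

lemma card_open_nbhd_insert:
  "card (open_nbhd (insert v S)) = card (open_nbhd S) + card (open_nbhd {v} - open_nbhd S)"
proof -
  have "open_nbhd (insert v S) = open_nbhd S \<union> (open_nbhd {v} - open_nbhd S)"
    by (subst open_nbhd_insert) auto
  also have "card \<dots> = card (open_nbhd S) + card (open_nbhd {v} - open_nbhd S)"
    by (rule card_Un_disjoint) auto
  finally show ?thesis .
qed

lemma card_open_nbhd_insert_playable:
  assumes "v \<in> playable S"
  shows "card (open_nbhd (insert v S)) \<ge> Suc (card (open_nbhd S))"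
proof -
  obtain u where "u \<in> open_nbhd {v} - open_nbhd S"
    using assms by (auto simp: playable_eq useful_def in_open_nbhd_singleton)
  then have "card (open_nbhd {v} - open_nbhd S) > 0"
    by (auto simp: card_gt_0_iff)
  then show ?thesis
    by (simp add: card_open_nbhd_insert)
qed

end

text \<open>\<open>m\<close>, \<open>t\<close>, \<open>c\<close> are the numbers of selected vertices, remaining moves and dominated vertices.\<close>

lemma moves_bound_arith:
  fixes d D m t n c :: nat
  assumes d: "d \<ge> 2" and D: "D \<ge> 2" and "m + d * t \<le> n" and "c + t \<le> n"
    and "3 * m + 2 * D \<le> 2 * c + 4"
  shows "(3 * real d - 2) * (real m + real t) + real D \<le> (2 * real d - 1) * real n + 2"
proof -
  have 1: "real m + real d * real t \<le> real n"
    using assms(3) by (metis of_nat_add of_nat_le_iff of_nat_mult)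
  have "3 * m + 2 * t + 2 * D \<le> 2 * n + 4"
    using assms(4,5) by linarith
  then have "3 * real m + 2 * real t + 2 * real D \<le> 2 * real n + 4"
    by linarith
  then have 2: "3 * real m + 2 * real t + 2 * (real D - 2) \<le> 2 * real n"
    by (simp add: algebra_simps)
  \<comment> \<open>The weights are chosen so that \<open>m + d * t\<close> plus
    \<open>(d - 1) * (3 * m + 2 * t)\<close> is \<open>(3 * d - 2) * (m + t)\<close>.\<close>
  have "(real d - 1) * (3 * real m + 2 * real t + 2 * (real D - 2)) \<le> (real d - 1) * (2 * real n)"
    using d by (intro mult_left_mono[OF 2]) simp
  \<comment> \<open>The surplus \<open>D - 2\<close> arrives with weight \<open>2 * (d - 1)\<close>,
    of which the conclusion keeps 1.\<close>
  moreover have "1 * (real D - 2) \<le> 2 * (real d - 1) * (real D - 2)"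
    using d D by (intro mult_right_mono) auto
  ultimately show ?thesis
    using 1 by (simp add: algebra_simps)
qed

section \<open>Induction along the game\<close>

context graph
begin

text \<open>The last hypothesis is an invariant: a Staller move raises \<open>3 * card S\<close> by
  3 and \<open>2 * card (open_nbhd S)\<close> by at least 2; a Dominator move that dominates two new
  vertices raises them by 3 and at least 4. So the constants 4 and 3 alternate until Dominator runs
  out of such moves.\<close>

lemma remaining_moves_bound:
  assumes d: "min_degree \<ge> 2" and D: "D \<ge> 2" and S: "S \<subseteq> verts G"
    and "3 * card S + 2 * D \<le> 2 * card (open_nbhd S) + (case p of Dominator \<Rightarrow> 4 | Staller \<Rightarrow> 3)"
  shows "(3 * real min_degree - 2) * (real (card S) + real (remaining_moves p S)) + real D
    \<le> (2 * real min_degree - 1) * real (card (verts G)) + 2"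
  using S assms(4)
proof (induction p S rule: remaining_moves.induct)
  case (1 S)
  have ins: "card (insert v S) = Suc (card S)" "insert v S \<subseteq> verts G" if "v \<in> playable S" for v
    using that playable_fresh[of S] 1(2) finite_subset[OF 1(2)] by auto
  show ?case
  proof (cases "\<exists>v \<in> playable S. card (open_nbhd {v} - open_nbhd S) \<ge> 2")
    case True
    then obtain v where v: "v \<in> playable S" "card (open_nbhd {v} - open_nbhd S) \<ge> 2"
      by blast
    then have ne: "playable S \<noteq> {}"
      by blast
    have "(3 * real min_degree - 2)
          * (real (card (insert v S)) + real (remaining_moves Staller (insert v S))) + real D
        \<le> (2 * real min_degree - 1) * real (card (verts G)) + 2"
      using 1(3) v ins[OF v(1)] by (intro 1(1)[OF ne v(1)]) (auto simp: card_open_nbhd_insert)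
    \<comment> \<open>An optimal move does at least as well as \<open>v\<close>, so the predicted
      total is at most the one after \<open>v\<close>.\<close>
    moreover have "real (card S) + real (remaining_moves Dominator S)
        \<le> real (card (insert v S)) + real (remaining_moves Staller (insert v S))"
      using ins(1)[OF v(1)] remaining_moves_Dominator_le[OF v(1)] by linarith
    then have "(3 * real min_degree - 2) * (real (card S) + real (remaining_moves Dominator S))
        \<le> (3 * real min_degree - 2)
          * (real (card (insert v S)) + real (remaining_moves Staller (insert v S)))"
      using d by (intro mult_left_mono) auto
    ultimately show ?thesis
      by linarith
  next
    case False
    let ?t = "remaining_moves Dominator S"
    \<comment> \<open>Every playable vertex now dominates a single new vertex, so counting alone
      bounds the rest of the game, however it is played.\<close>
    have "card (open_nbhd {v} - open_nbhd S) \<le> 1" if "v \<in> playable S" for v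
      using False that by force
    then have "card S + min_degree * card (useful S) \<le> card (verts G)"
      using 1(2) by (intro card_add_useful_le) auto
    moreover have "min_degree * ?t \<le> min_degree * card (useful S)"
      using remaining_moves_le_card_useful by (rule mult_le_mono2)
    ultimately have "card S + min_degree * ?t \<le> card (verts G)"
      by linarith
    then show ?thesis
      using 1(3) card_open_nbhd_add_useful[of S] remaining_moves_le_card_useful[of Dominator S]
      by (intro moves_bound_arith[where c = "card (open_nbhd S)"] d D) auto
  qed
next
  case (2 S)
  show ?case
  proof (cases "playable S = {}")
    case True
    \<comment> \<open>With no moves left, \<open>t = 0\<close>, and the two counting conditions are
      just these inequalities.\<close>
    have "card S \<le> card (verts G)" "card (open_nbhd S) \<le> card (verts G)"
      using 2(2) open_nbhd_subset by (simp_all add: card_mono)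
    then show ?thesis
      using True 2(3) remaining_moves_eq_0[OF True]
      by (intro moves_bound_arith[where c = "card (open_nbhd S)"] d D) auto
  next
    case False
    then obtain v where v: "v \<in> playable S"
      and eq: "remaining_moves Staller S = Suc (remaining_moves Dominator (insert v S))"
      by (rule remaining_moves_Staller_attained)
    have ins: "card (insert v S) = Suc (card S)" "insert v S \<subseteq> verts G"
      using v playable_fresh[of S] 2(2) finite_subset[OF 2(2)] by auto
    have "(3 * real min_degree - 2)
          * (real (card (insert v S)) + real (remaining_moves Dominator (insert v S))) + real D
        \<le> (2 * real min_degree - 1) * real (card (verts G)) + 2"
      using 2(3) ins card_open_nbhd_insert_playable[OF v]
      by (intro 2(1)[OF False v]) auto
    then show ?thesis
      using ins(1) eq by (simp add: add_ac)
  qed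
qed

lemma game_total_isolation_number_bound:
  assumes d: "min_degree \<ge> 2" and ne: "verts G \<noteq> {}"
  shows "(3 * real min_degree - 2) * real game_total_isolation_number + real max_degree
    \<le> (2 * real min_degree - 1) * real (card (verts G)) + 2"
proof -
  have "max_degree \<in> out_degree G ` verts G"
    unfolding max_degree_def using ne by (intro Max_in) auto
  then obtain v where v: "v \<in> verts G" "card (open_nbhd {v}) = max_degree"
    by (auto simp: card_open_nbhd_singleton)
  have D: "max_degree \<ge> 2"
    using d min_degree_le[OF v(1)] v(2) by linarith
  then obtain u where u: "v \<rightarrow> u"
    using v(2) by (metis card.empty equals0I in_open_nbhd_singleton not_numeral_le_zero)
  \<comment> \<open>Nothing is dominated yet, so \<open>u\<close> is useful because of its neighbour
    \<open>v\<close>, and the opening move is legal.\<close>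
  have "u \<in> useful {}"
    using u dominates_sym[of u v] adj_in_verts(1)[OF u] adj_in_verts(2)[OF u]
    by (auto simp: useful_def open_nbhd_def)
  with u have pl: "v \<in> playable {}"
    by (auto simp: playable_eq)
  \<comment> \<open>With \<open>D\<close> the maximum degree, the opening move meets the invariant
    for Staller with equality: \<open>3 * 1 + 2 * D = 2 * D + 3\<close>.\<close>
  have "(3 * real min_degree - 2) * (real (card {v}) + real (remaining_moves Staller {v}))
      + real max_degree \<le> (2 * real min_degree - 1) * real (card (verts G)) + 2"
    using v by (intro remaining_moves_bound d D) auto
  moreover have "game_total_isolation_number \<le> Suc (remaining_moves Staller {v})"
    unfolding game_total_isolation_number_def by (rule remaining_moves_Dominator_le[OF pl])
  then have "(3 * real min_degree - 2) * real game_total_isolation_number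
      \<le> (3 * real min_degree - 2) * (real (card {v}) + real (remaining_moves Staller {v}))"
    using d by (intro mult_left_mono) auto
  ultimately show ?thesis
    by linarith
qed

end

theorem theorem3p1:
  fixes G :: "('a, 'b) pre_digraph" and n \<delta> \<Delta> :: nat
  assumes "graph G"
    and "Digraph_Component.connected G"
    and "n = card (verts G)" and "n \<ge> 3"
    and "\<delta> = graph.min_degree G" and "\<delta> \<ge> 2"
    and "\<Delta> = graph.max_degree G"
  shows "real (graph.game_total_isolation_number G)
    \<le> ((2 * real \<delta> - 1) / (3 * real \<delta> - 2)) * real n - (real \<Delta> - 2) / (3 * real \<delta> - 2)"
proof -
  have "(3 * real \<delta> - 2) * real (graph.game_total_isolation_number G) + real \<Delta>
      \<le> (2 * real \<delta> - 1) * real n + 2"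
    using graph.game_total_isolation_number_bound[OF assms(1)] assms by fastforce
  moreover have "3 * real \<delta> - 2 > 0"
    using assms(6) by simp
  ultimately have "real (graph.game_total_isolation_number G)
      \<le> ((2 * real \<delta> - 1) * real n - (real \<Delta> - 2)) / (3 * real \<delta> - 2)"
    by (simp add: pos_le_divide_eq mult.commute)
  also have "\<dots> = ((2 * real \<delta> - 1) / (3 * real \<delta> - 2)) * real n
      - (real \<Delta> - 2) / (3 * real \<delta> - 2)"
    by (subst diff_divide_distrib) simp
  finally show ?thesis .
qed

end
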